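(* The assignment $G\mapsto \Pi(G)$ (the fundamental groupoid) on graphs, together with the assignment to each graph morphism $\phi: G\to H$ of the map $\phi_*:\Pi(G)\to\Pi(H)$ given by $\phi_*(v)=\phi(v)$ on objects and $\phi_*[(v_0v_1\dots v_n)]=[(\phi(v_0)\phi(v_1)\dots\phi(v_n))]$ on arrows, defines a functor from the category $\mathsf{Gph}$ of graphs to the category of groupoids.
   Context: A graph $G$ is undirected without multiple edges, loops allowed: a vertex set $V(G)$ with a symmetric adjacency relation $\sim$ (edges). A graph morphism $f: G\to H$ is a map $V(G)\to V(H)$ with $v_1\sim v_2 \Rightarrow f(v_1)\sim f(v_2)$. These form the category $\mathsf{Gph}$. The product $G\times H$ has vertices $V(G)\times V(H)$, with $(v_1,w_1)\sim(v_2,w_2)$ iff $v_1\sim v_2$ and $w_1\sim w_2$. $P_n$ is the graph on $\{0,\dots,n\}$ whose edges are $i\sim i+1$; $I_n^\ell$ is the graph on $\{0,\dots,n\}$ whose edges are $i\sim i$ and $i\sim i+1$. A walk of length $n\ge0$ in $G$ from $v_0$ to $v_n$ is a morphism $P_n\to G$, written $(v_0v_1\dots v_n)$. Concatenation of $(x v_1\dots v_{n-1}y)$ with $(y w_1\dots w_{m-1}z)$ is $(x v_1\dots v_{n-1}y w_1\dots w_{m-1}z)$. If $v_i=v_{i+2}$ in a walk, the prune at $i$ is the walk obtained by deleting the entries $v_i,v_{i+1}$. Two walks $\alpha,\beta$ of length $n$ from $x$ to $y$ are homotopic rel endpoints if there are $m\ge 0$ and a morphism $\Lambda:P_n\times I_m^\ell\to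 G$ with $\Lambda(\cdot,0)=\alpha$, $\Lambda(\cdot,m)=\beta$, and $\Lambda(0,j)=x$, $\Lambda(n,j)=y$ for all $j$. The fundamental groupoid $\Pi(G)$ has as objects the vertices of $G$; arrows from $v$ to $w$ are equivalence classes of walks from $v$ to $w$ under the equivalence relation generated by prunes and homotopy rel endpoints; composition is induced by concatenation, identities are the length-$0$ walks. *)

theory Defs
  imports Main "HOL-Library.FuncSet"
begin

section \<open>Categories, functors, groupoids\<close>

text \<open>Hom-sets are indexed by source and target and need not be disjoint, so composition and
  the arrow part of a functor also take the objects involved:
  for \<open>f : x \<rightarrow> y\<close> and \<open>g : y \<rightarrow> z\<close> the composite \<open>g \<circ> f\<close> is \<open>Comp C x y z g f\<close>.
  Values outside the objects and hom-sets carry no meaning.\<close>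

record ('o, 'm) cat =
  Obj :: "'o set"
  Hom :: "'o \<Rightarrow> 'o \<Rightarrow> 'm set"
  Ident :: "'o \<Rightarrow> 'm"
  Comp :: "'o \<Rightarrow> 'o \<Rightarrow> 'o \<Rightarrow> 'm \<Rightarrow> 'm \<Rightarrow> 'm"

locale category =
  fixes C :: "('o, 'm) cat"
  assumes ident_hom: "x \<in> Obj C \<Longrightarrow> Ident C x \<in> Hom C x x"
    and comp_hom: "\<lbrakk>x \<in> Obj C; y \<in> Obj C; z \<in> Obj C; f \<in> Hom C x y; g \<in> Hom C y z\<rbrakk>
      \<Longrightarrow> Comp C x y z g f \<in> Hom C x z"
    and comp_ident_right: "\<lbrakk>x \<in> Obj C; y \<in> Obj C; f \<in> Hom C x y\<rbrakk>
      \<Longrightarrow> Comp C x x y f (Ident C x) = f"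
    and comp_ident_left: "\<lbrakk>x \<in> Obj C; y \<in> Obj C; f \<in> Hom C x y\<rbrakk>
      \<Longrightarrow> Comp C x y y (Ident C y) f = f"
    and comp_assoc: "\<lbrakk>w \<in> Obj C; x \<in> Obj C; y \<in> Obj C; z \<in> Obj C;
        f \<in> Hom C w x; g \<in> Hom C x y; h \<in> Hom C y z\<rbrakk>
      \<Longrightarrow> Comp C w y z h (Comp C w x y g f) = Comp C w x z (Comp C x y z h g) f"

locale groupoid = category +
  assumes inverse: "\<lbrakk>x \<in> Obj C; y \<in> Obj C; f \<in> Hom C x y\<rbrakk>
      \<Longrightarrow> \<exists>g \<in> Hom C y x. Comp C x y x g f = Ident C x \<and> Comp C y x y f g = Ident C y"

record ('o, 'm, 'p, 'n) cat_functor =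
  omap :: "'o \<Rightarrow> 'p"
  amap :: "'o \<Rightarrow> 'o \<Rightarrow> 'm \<Rightarrow> 'n"

locale is_functor =
  source: category C + target: category D
  for C :: "('o, 'm) cat" and D :: "('p, 'n) cat" +
  fixes F :: "('o, 'm, 'p, 'n) cat_functor"
  assumes omap_obj: "x \<in> Obj C \<Longrightarrow> omap F x \<in> Obj D"
    and amap_hom: "\<lbrakk>x \<in> Obj C; y \<in> Obj C; f \<in> Hom C x y\<rbrakk>
      \<Longrightarrow> amap F x y f \<in> Hom D (omap F x) (omap F y)"
    and amap_ident: "x \<in> Obj C \<Longrightarrow> amap F x x (Ident C x) = Ident D (omap F x)"
    and amap_comp: "\<lbrakk>x \<in> Obj C; y \<in> Obj C; z \<in> Obj C; f \<in> Hom C x y; g \<in> Hom C y z\<rbrakk>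
      \<Longrightarrow> amap F x z (Comp C x y z g f)
          = Comp D (omap F x) (omap F y) (omap F z) (amap F y z g) (amap F x y f)"

text \<open>Normalising a functor to \<open>undefined\<close> off the objects and hom-sets of its source; among
  normalised functors HOL equality is the intended equality of functors.\<close>

definition restrict_functor ::
    "('o, 'm) cat \<Rightarrow> ('o, 'm, 'p, 'n) cat_functor \<Rightarrow> ('o, 'm, 'p, 'n) cat_functor" where
  "restrict_functor C F =
    \<lparr>omap = (\<lambda>x\<in>Obj C. omap F x),
     amap = (\<lambda>x y f. if x \<in> Obj C \<and> y \<in> Obj C \<and> f \<in> Hom C x y
                      then amap F x y f else undefined)\<rparr>"

definition Grpd :: "(('o, 'm) cat, ('o, 'm, 'o, 'm) cat_functor) cat" where
  "Grpd =
    \<lparr>Obj = {C. groupoid C},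
     Hom = (\<lambda>C D. {F. is_functor C D F \<and> restrict_functor C F = F}),
     Ident = (\<lambda>C. restrict_functor C \<lparr>omap = (\<lambda>x. x), amap = (\<lambda>x y f. f)\<rparr>),
     Comp = (\<lambda>C D E F' F. restrict_functor C
       \<lparr>omap = (\<lambda>x. omap F' (omap F x)),
        amap = (\<lambda>x y f. amap F' (omap F x) (omap F y) (amap F x y f))\<rparr>)\<rparr>"


section \<open>Graphs\<close>

record 'a graph =
  verts :: "'a set"
  adj :: "('a \<times> 'a) set"

definition is_graph :: "'a graph \<Rightarrow> bool" where
  "is_graph G \<longleftrightarrow> adj G \<subseteq> verts G \<times> verts G \<and> sym (adj G)"

definition graph_morphism :: "'a graph \<Rightarrow> 'b graph \<Rightarrow> ('a \<Rightarrow> 'b) \<Rightarrow> bool" where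
  "graph_morphism G H f \<longleftrightarrow>
     f \<in> verts G \<rightarrow> verts H \<and> (\<forall>u v. (u, v) \<in> adj G \<longrightarrow> (f u, f v) \<in> adj H)"

text \<open>All graphs whose vertices are drawn from the (arbitrary) type \<open>'a\<close>. Arrows are taken
  extensional, so that they are determined by their values on the vertex set.\<close>

definition Gph :: "('a graph, 'a \<Rightarrow> 'a) cat" where
  "Gph =
    \<lparr>Obj = {G. is_graph G},
     Hom = (\<lambda>G H. {f. graph_morphism G H f \<and> f \<in> extensional (verts G)}),
     Ident = (\<lambda>G. \<lambda>v\<in>verts G. v),
     Comp = (\<lambda>G H K g f. compose (verts G) g f)\<rparr>"

definition graph_prod :: "'a graph \<Rightarrow> 'b graph \<Rightarrow> ('a \<times> 'b) graph" where
  "graph_prod G H =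
    \<lparr>verts = verts G \<times> verts H,
     adj = {((v1, w1), (v2, w2)). (v1, v2) \<in> adj G \<and> (w1, w2) \<in> adj H}\<rparr>"

definition path_graph :: "nat \<Rightarrow> nat graph" where
  "path_graph n =
    \<lparr>verts = {0..n},
     adj = {(i, j). i \<le> n \<and> j \<le> n \<and> (j = i + 1 \<or> i = j + 1)}\<rparr>"

definition looped_path_graph :: "nat \<Rightarrow> nat graph" where
  "looped_path_graph n =
    \<lparr>verts = {0..n},
     adj = {(i, j). i \<le> n \<and> j \<le> n \<and> (i = j \<or> j = i + 1 \<or> i = j + 1)}\<rparr>"


section \<open>Walks and the fundamental groupoid\<close>

text \<open>The walk \<open>(v\<^sub>0 v\<^sub>1 \<dots> v\<^sub>n)\<close> is the list of its \<open>n + 1\<close> entries.\<close>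

definition is_walk :: "'a graph \<Rightarrow> 'a list \<Rightarrow> bool" where
  "is_walk G \<alpha> \<longleftrightarrow> \<alpha> \<noteq> [] \<and> graph_morphism (path_graph (length \<alpha> - 1)) G (\<lambda>i. \<alpha> ! i)"

definition walks :: "'a graph \<Rightarrow> 'a \<Rightarrow> 'a \<Rightarrow> 'a list set" where
  "walks G x y = {\<alpha>. is_walk G \<alpha> \<and> hd \<alpha> = x \<and> last \<alpha> = y}"

definition walk_concat :: "'a list \<Rightarrow> 'a list \<Rightarrow> 'a list" where
  "walk_concat \<alpha> \<beta> = \<alpha> @ tl \<beta>"

definition prunes_to :: "'a graph \<Rightarrow> 'a list \<Rightarrow> 'a list \<Rightarrow> bool" where
  "prunes_to G \<alpha> \<beta> \<longleftrightarrow> is_walk G \<alpha> \<and>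
     (\<exists>i. i + 2 < length \<alpha> \<and> \<alpha> ! i = \<alpha> ! (i + 2) \<and> \<beta> = take i \<alpha> @ drop (i + 2) \<alpha>)"

definition homotopic_rel_endpoints :: "'a graph \<Rightarrow> 'a list \<Rightarrow> 'a list \<Rightarrow> bool" where
  "homotopic_rel_endpoints G \<alpha> \<beta> \<longleftrightarrow>
     (\<exists>n x y. \<alpha> \<in> walks G x y \<and> \<beta> \<in> walks G x y \<and> length \<alpha> = n + 1 \<and> length \<beta> = n + 1 \<and>
       (\<exists>m \<Lambda>. graph_morphism (graph_prod (path_graph n) (looped_path_graph m)) G \<Lambda> \<and>
         (\<forall>i\<le>n. \<Lambda> (i, 0) = \<alpha> ! i) \<and> (\<forall>i\<le>n. \<Lambda> (i, m) = \<beta> ! i) \<and>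
         (\<forall>j\<le>m. \<Lambda> (0, j) = x \<and> \<Lambda> (n, j) = y)))"

definition walk_equiv :: "'a graph \<Rightarrow> 'a list \<Rightarrow> 'a list \<Rightarrow> bool" where
  "walk_equiv G = equivclp (\<lambda>\<alpha> \<beta>. prunes_to G \<alpha> \<beta> \<or> homotopic_rel_endpoints G \<alpha> \<beta>)"

definition walk_class :: "'a graph \<Rightarrow> 'a list \<Rightarrow> 'a list set" where
  "walk_class G \<alpha> = {\<beta>. is_walk G \<beta> \<and> walk_equiv G \<alpha> \<beta>}"

text \<open>Operations on classes are unions over all representatives; such a union is again a class
  only if the operation on representatives respects the equivalence.\<close>

definition fundamental_groupoid :: "'a graph \<Rightarrow> ('a, 'a list set) cat" where
  "fundamental_groupoid G =
    \<lparr>Obj = verts G,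
     Hom = (\<lambda>x y. walk_class G ` walks G x y),
     Ident = (\<lambda>x. walk_class G [x]),
     Comp = (\<lambda>x y z d c. \<Union>\<alpha>\<in>c. \<Union>\<beta>\<in>d. walk_class G (walk_concat \<alpha> \<beta>))\<rparr>"

definition induced_functor ::
    "'a graph \<Rightarrow> 'b graph \<Rightarrow> ('a \<Rightarrow> 'b) \<Rightarrow> ('a, 'a list set, 'b, 'b list set) cat_functor" where
  "induced_functor G H \<phi> = restrict_functor (fundamental_groupoid G)
    \<lparr>omap = \<phi>, amap = (\<lambda>x y c. \<Union>\<alpha>\<in>c. walk_class H (map \<phi> \<alpha>))\<rparr>"

end

theory Submission
  imports Defs
begin

text \<open>A single prune or homotopy of a walk survives adding one edge at either end of the walk and
  applying a graph morphism to its entries. Adding edges one at a time, concatenation respects the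
  generated equivalence in both arguments. The inverse of a walk is its reversal: by induction the
  inner part of \<open>(v\<^sub>0 v\<^sub>1 \<dots> v\<^sub>n \<dots> v\<^sub>1 v\<^sub>0)\<close> reduces to \<open>(v\<^sub>1)\<close>, and \<open>(v\<^sub>0 v\<^sub>1 v\<^sub>0)\<close> prunes to \<open>(v\<^sub>0)\<close>.\<close>

section \<open>The category of groupoids\<close>

text \<open>Adding an edge works because a homotopy rel endpoints is constant at its two ends: the
  new column can be held at the added vertex, and each edge between it and the old homotopy goes to
  one fixed endpoint. The closure is formed over all lists, whereas such an extension is legal only
  for walks with the right endpoint. Single steps relate walks only and keep both endpoints, so
  every list in a chain of steps that starts at a walk satisfies the condition. Units, associativity
  and compatibility with morphisms already hold as equalities of lists. Beyond well-definedness on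
  classes, only inverses draw on the equivalence. The remaining care concerns arguments outside
  vertex sets, objects and hom-sets: arrows of \<open>Gph\<close> are extensional and arrows of
  \<open>Grpd\<close> are normalised, so identities and composites agree with the plain formulas
  only on meaningful arguments.\<close>

lemma omap_restrict_functor [simp]: "x \<in> Obj C \<Longrightarrow> omap (restrict_functor C F) x = omap F x"
  by (simp add: restrict_functor_def)

lemma amap_restrict_functor [simp]:
  "\<lbrakk>x \<in> Obj C; y \<in> Obj C; f \<in> Hom C x y\<rbrakk> \<Longrightarrow> amap (restrict_functor C F) x y f = amap F x y f"
  by (simp add: restrict_functor_def)

lemma restrict_functor_cong:
  assumes "\<And>x. x \<in> Obj C \<Longrightarrow> omap F x = omap F' x"
    and "\<And>x y f. \<lbrakk>x \<in> Obj C; y \<in> Obj C; f \<in> Hom C x y\<rbrakk> \<Longrightarrow> amap F x y f = amap F' x y f"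
  shows "restrict_functor C F = restrict_functor C F'"
  using assms by (auto simp: restrict_functor_def fun_eq_iff)

lemma restrict_functor_idem [simp]:
  "restrict_functor C (restrict_functor C F) = restrict_functor C F"
  by (rule restrict_functor_cong) simp_all

text \<open>Normalisation fixes all values off the objects and hom-sets, so only meaningful
  arguments remain to be compared. Every equation between arrows of \<open>Grpd\<close> is proved in
  this form, including the two laws for the assignment \<open>fundamental_groupoid\<close>.\<close>

lemma normalised_functor_eqI:
  assumes "restrict_functor C F = F" "restrict_functor C F' = F'"
    and "\<And>x. x \<in> Obj C \<Longrightarrow> omap F x = omap F' x"
    and "\<And>x y f. \<lbrakk>x \<in> Obj C; y \<in> Obj C; f \<in> Hom C x y\<rbrakk> \<Longrightarrow> amap F x y f = amap F' x y f"
  shows "F = F'"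
  using restrict_functor_cong[of C F F'] assms by simp

text \<open>The axioms evaluate a functor only at objects and arrows of its source. The closure of
  hom-sets under identities and composition ensures that these two also lie where the restriction
  changes nothing.\<close>

lemma is_functor_restrict:
  assumes "is_functor C D F"
  shows "is_functor C D (restrict_functor C F)"
proof -
  interpret is_functor C D F by fact
  show ?thesis
    by unfold_locales
      (simp_all add: omap_obj amap_hom amap_ident amap_comp source.ident_hom source.comp_hom)
qed

lemma is_functor_id:
  assumes "category C"
  shows "is_functor C C \<lparr>omap = (\<lambda>x. x), amap = (\<lambda>x y f. f)\<rparr>"
proof -
  interpret category C by fact
  show ?thesis by unfold_locales simp_all
qed

lemma is_functor_comp:
  assumes "is_functor C D F" "is_functor D E F'"
  shows "is_functor C E \<lparr>omap = (\<lambda>x. omap F' (omap F x)),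
    amap = (\<lambda>x y f. amap F' (omap F x) (omap F y) (amap F x y f))\<rparr>"
proof -
  interpret F: is_functor C D F by fact
  interpret F': is_functor D E F' by fact
  show ?thesis
    by unfold_locales
      (simp_all add: F.omap_obj F.amap_hom F.amap_ident F.amap_comp
        F'.omap_obj F'.amap_hom F'.amap_ident F'.amap_comp)
qed

lemma category_Grpd: "category (Grpd :: (('o, 'm) cat, ('o, 'm, 'o, 'm) cat_functor) cat)"
proof
  fix C :: "('o, 'm) cat"
  assume "C \<in> Obj Grpd"
  then show "Ident Grpd C \<in> Hom Grpd C C"
    by (simp add: Grpd_def groupoid.axioms(1) is_functor_id is_functor_restrict)
next
  fix C D E :: "('o, 'm) cat" and F F'
  assume "F \<in> Hom Grpd C D" "F' \<in> Hom Grpd D E"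
  then have "is_functor C D F" "is_functor D E F'"
    by (simp_all add: Grpd_def)
  then show "Comp Grpd C D E F' F \<in> Hom Grpd C E"
    by (simp add: Grpd_def is_functor_comp[of C D F E F'] is_functor_restrict)
next
  fix C D :: "('o, 'm) cat" and F
  assume "F \<in> Hom Grpd C D"
  then have F: "is_functor C D F" "restrict_functor C F = F"
    by (simp_all add: Grpd_def)
  interpret is_functor C D F by fact
  show "Comp Grpd C C D F (Ident Grpd C) = F"
    by (rule normalised_functor_eqI[of C]) (simp_all add: F Grpd_def)
  show "Comp Grpd C D D (Ident Grpd D) F = F"
    by (rule normalised_functor_eqI[of C]) (simp_all add: F Grpd_def omap_obj amap_hom)
next
  fix B C D E :: "('o, 'm) cat" and F F' F''
  assume "F \<in> Hom Grpd B C" "F' \<in> Hom Grpd C D" "F'' \<in> Hom Grpd D E"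
  then have F: "is_functor B C F" "is_functor C D F'" "is_functor D E F''"
    by (simp_all add: Grpd_def)
  interpret F: is_functor B C F by fact
  interpret F': is_functor C D F' by fact
  \<comment> \<open>Both bracketings contain an inner normalisation. It is removed by checking that
    images of objects and arrows again lie in the next groupoid, which is what the
    \<open>omap_obj\<close> and \<open>amap_hom\<close> facts supply.\<close>
  show "Comp Grpd B D E F'' (Comp Grpd B C D F' F) = Comp Grpd B C E (Comp Grpd C D E F'' F') F"
    by (rule normalised_functor_eqI[of B])
      (simp_all add: Grpd_def F.omap_obj F.amap_hom F'.omap_obj F'.amap_hom)
qed


section \<open>The category of graphs\<close>

lemma graph_morphism_in_verts: "graph_morphism G H f \<Longrightarrow> v \<in> verts G \<Longrightarrow> f v \<in> verts H"
  by (auto simp: graph_morphism_def)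

lemma graph_morphism_comp:
  "graph_morphism G H f \<Longrightarrow> graph_morphism H K g \<Longrightarrow> graph_morphism G K (g \<circ> f)"
  by (auto simp: graph_morphism_def)

text \<open>Edges of a graph join vertices, so values off the vertex set do not influence
  preservation of adjacency. This permits passing between extensional functions and plain ones, and
  between list indexing and its values within bounds.\<close>

lemma graph_morphism_cong:
  assumes "is_graph G" "\<And>v. v \<in> verts G \<Longrightarrow> f v = f' v"
  shows "graph_morphism G H f \<longleftrightarrow> graph_morphism G H f'"
proof -
  have "u \<in> verts G \<and> v \<in> verts G" if "(u, v) \<in> adj G" for u v
    using assms(1) that by (auto simp: is_graph_def)
  then show ?thesis
    using assms(2) by (auto simp: graph_morphism_def Pi_iff)
qed

lemma category_Gph: "category Gph"
proof
  fix G :: "'a graph"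
  assume G: "G \<in> Obj Gph"
  then have "graph_morphism G G (\<lambda>v\<in>verts G. v) \<longleftrightarrow> graph_morphism G G (\<lambda>v. v)"
    by (intro graph_morphism_cong) (simp_all add: Gph_def)
  then show "Ident Gph G \<in> Hom Gph G G"
    by (simp add: Gph_def graph_morphism_def)
next
  fix G H K :: "'a graph" and f g
  assume *: "G \<in> Obj Gph" "f \<in> Hom Gph G H" "g \<in> Hom Gph H K"
  then have "graph_morphism G K (compose (verts G) g f) \<longleftrightarrow> graph_morphism G K (g \<circ> f)"
    by (intro graph_morphism_cong) (simp_all add: Gph_def compose_def)
  with * show "Comp Gph G H K g f \<in> Hom Gph G K"
    by (simp add: Gph_def graph_morphism_comp[of G H f K g])
next
  fix G H :: "'a graph" and f
  assume "f \<in> Hom Gph G H"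
  then have f: "f \<in> verts G \<rightarrow> verts H" "f \<in> extensional (verts G)"
    by (simp_all add: Gph_def graph_morphism_def)
  show "Comp Gph G G H f (Ident Gph G) = f"
    using f by (simp add: Gph_def compose_Id)
  show "Comp Gph G H H (Ident Gph H) f = f"
    using f by (simp add: Gph_def Id_compose)
next
  fix G H K L :: "'a graph" and f g h
  assume "f \<in> Hom Gph G H"
  then have "f \<in> verts G \<rightarrow> verts H"
    by (simp add: Gph_def graph_morphism_def)
  then show "Comp Gph G K L h (Comp Gph G H K g f) = Comp Gph G H L (Comp Gph H K L h g) f"
    by (simp add: Gph_def compose_assoc)
qed


section \<open>Walks and their equivalence\<close>

text \<open>The path graph contains each edge in both orientations; symmetry of adjacency reduces
  the morphism condition to consecutive entries in forward order. For a single entry the adjacency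
  condition is empty and membership in the vertex set is the whole content.\<close>

lemma is_walk_iff_successively:
  assumes "is_graph G"
  shows "is_walk G \<alpha> \<longleftrightarrow>
    \<alpha> \<noteq> [] \<and> set \<alpha> \<subseteq> verts G \<and> successively (\<lambda>u v. (u, v) \<in> adj G) \<alpha>"
proof (cases "\<alpha> = []")
  case False
  have sym: "(u, v) \<in> adj G \<longleftrightarrow> (v, u) \<in> adj G" for u v
    using assms by (auto simp: is_graph_def sym_def)
  have verts: "(\<lambda>i. \<alpha> ! i) \<in> {0..length \<alpha> - 1} \<rightarrow> verts G \<longleftrightarrow> set \<alpha> \<subseteq> verts G"
    using False unfolding Pi_iff subset_iff in_set_conv_nth
    by (metis One_nat_def Suc_pred atLeastAtMost_iff le0 length_greater_0_conv less_Suc_eq_le)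
  have "(\<forall>i j. i \<le> length \<alpha> - 1 \<and> j \<le> length \<alpha> - 1 \<and> (j = i + 1 \<or> i = j + 1)
          \<longrightarrow> (\<alpha> ! i, \<alpha> ! j) \<in> adj G)
      \<longleftrightarrow> (\<forall>i. Suc i < length \<alpha> \<longrightarrow> (\<alpha> ! i, \<alpha> ! Suc i) \<in> adj G)"
    using False sym by (auto simp: le_diff_conv2 Suc_le_eq)
  with False verts show ?thesis
    by (simp add: is_walk_def graph_morphism_def path_graph_def successively_conv_nth)
qed (simp add: is_walk_def)

lemma is_walk_singleton: "is_graph G \<Longrightarrow> is_walk G [x] \<longleftrightarrow> x \<in> verts G"
  by (simp add: is_walk_iff_successively)

lemma is_walk_Cons:
  assumes "is_graph G" "\<alpha> \<noteq> []"
  shows "is_walk G (v # \<alpha>) \<longleftrightarrow> (v, hd \<alpha>) \<in> adj G \<and> is_walk G \<alpha>"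
  using assms by (auto simp: is_walk_iff_successively successively_Cons is_graph_def)

lemma is_walk_snoc:
  assumes "is_graph G" "\<alpha> \<noteq> []"
  shows "is_walk G (\<alpha> @ [v]) \<longleftrightarrow> (last \<alpha>, v) \<in> adj G \<and> is_walk G \<alpha>"
  using assms by (auto simp: is_walk_iff_successively successively_append_iff is_graph_def)

lemma is_walk_rev:
  assumes "is_graph G"
  shows "is_walk G (rev \<alpha>) \<longleftrightarrow> is_walk G \<alpha>"
proof -
  have "(v, u) \<in> adj G \<longleftrightarrow> (u, v) \<in> adj G" for u v
    using assms by (auto simp: is_graph_def sym_def)
  then show ?thesis
    using assms by (simp add: is_walk_iff_successively)
qed

lemma is_walk_map:
  assumes "is_walk G \<alpha>" "graph_morphism G H \<phi>"
  shows "is_walk H (map \<phi> \<alpha>)"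
proof -
  have P: "is_graph (path_graph n)" for n
    by (auto simp: is_graph_def path_graph_def sym_def)
  \<comment> \<open>Indexing commutes with \<open>map\<close> only within bounds. These bounds are
    exactly the vertices of the path graph, so the congruence applies.\<close>
  have "graph_morphism (path_graph (length \<alpha> - 1)) H (\<lambda>i. map \<phi> \<alpha> ! i) \<longleftrightarrow>
      graph_morphism (path_graph (length \<alpha> - 1)) H (\<phi> \<circ> (\<lambda>i. \<alpha> ! i))"
    using assms(1) by (intro graph_morphism_cong[OF P])
      (cases \<alpha>, auto simp: path_graph_def is_walk_def less_Suc_eq_le nth_map simp del: list.map)
  then show ?thesis
    using assms graph_morphism_comp[OF _ assms(2)] by (auto simp: is_walk_def)
qed

section \<open>Concatenation, reversal and images of walks\<close>

lemma walk_concat_singleton_left: "\<alpha> \<noteq> [] \<Longrightarrow> walk_concat [hd \<alpha>] \<alpha> = \<alpha>"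
  by (simp add: walk_concat_def)

lemma walk_concat_singleton_right: "walk_concat \<alpha> [x] = \<alpha>"
  by (simp add: walk_concat_def)

text \<open>Associativity is strict. The middle list must be nonempty: otherwise the nested
  \<open>tl\<close> on the right would remove a second entry of \<gamma>.\<close>

lemma walk_concat_assoc:
  "\<beta> \<noteq> [] \<Longrightarrow> walk_concat (walk_concat \<alpha> \<beta>) \<gamma> = walk_concat \<alpha> (walk_concat \<beta> \<gamma>)"
  by (simp add: walk_concat_def)

lemma map_walk_concat: "map \<phi> (walk_concat \<alpha> \<beta>) = walk_concat (map \<phi> \<alpha>) (map \<phi> \<beta>)"
  by (simp add: walk_concat_def map_tl)

lemma walk_concat_walks:
  assumes "is_graph G" "\<alpha> \<in> walks G x y" "\<beta> \<in> walks G y z"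
  shows "walk_concat \<alpha> \<beta> \<in> walks G x z"
proof -
  from assms(3) obtain \<delta> where \<delta>: "\<beta> = y # \<delta>"
    by (cases \<beta>) (auto simp: walks_def is_walk_def)
  with assms show ?thesis
    by (auto simp: walks_def walk_concat_def is_walk_iff_successively
        successively_append_iff successively_Cons)
qed

lemma walks_rev: "is_graph G \<Longrightarrow> \<alpha> \<in> walks G x y \<Longrightarrow> rev \<alpha> \<in> walks G y x"
  by (simp add: walks_def is_walk_rev hd_rev last_rev)

lemma walks_map:
  "\<alpha> \<in> walks G x y \<Longrightarrow> graph_morphism G H \<phi> \<Longrightarrow> map \<phi> \<alpha> \<in> walks H (\<phi> x) (\<phi> y)"
  using is_walk_map[of G \<alpha> H \<phi>] by (auto simp: walks_def hd_map last_map is_walk_def)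

text \<open>Index arithmetic is replaced by a splitting of the list around the backtracking
  \<open>u v u\<close>. This shape is visibly stable under prepending, appending and
  mapping.\<close>

lemma prunes_to_iff:
  "prunes_to G \<alpha> \<beta> \<longleftrightarrow> is_walk G \<alpha> \<and> (\<exists>p u v q. \<alpha> = p @ [u, v, u] @ q \<and> \<beta> = p @ [u] @ q)"
proof
  assume "prunes_to G \<alpha> \<beta>"
  then obtain i where i: "is_walk G \<alpha>" "i + 2 < length \<alpha>" "\<alpha> ! i = \<alpha> ! (i + 2)"
      "\<beta> = take i \<alpha> @ drop (i + 2) \<alpha>"
    by (auto simp: prunes_to_def)
  \<comment> \<open>Three entries are split off at \<open>i\<close>. The pruned walk keeps only the
    third of them, which equals the first, so it can be written with the same
    \<open>u\<close>.\<close>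
  have "drop i \<alpha> = [\<alpha> ! i, \<alpha> ! (i + 1), \<alpha> ! i] @ drop (i + 3) \<alpha>"
    using i(2,3) by (simp add: Cons_nth_drop_Suc[symmetric] numeral_3_eq_3)
  moreover have "drop (i + 2) \<alpha> = [\<alpha> ! i] @ drop (i + 3) \<alpha>"
    using i(2,3) by (simp add: Cons_nth_drop_Suc[symmetric] numeral_3_eq_3)
  ultimately have "\<alpha> = take i \<alpha> @ [\<alpha> ! i, \<alpha> ! (i + 1), \<alpha> ! i] @ drop (i + 3) \<alpha>"
    "\<beta> = take i \<alpha> @ [\<alpha> ! i] @ drop (i + 3) \<alpha>"
    using i(4) append_take_drop_id[of i \<alpha>] by simp_all
  with i(1) show "is_walk G \<alpha> \<and> (\<exists>p u v q. \<alpha> = p @ [u, v, u] @ q \<and> \<beta> = p @ [u] @ q)"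
    by blast
next
  assume "is_walk G \<alpha> \<and> (\<exists>p u v q. \<alpha> = p @ [u, v, u] @ q \<and> \<beta> = p @ [u] @ q)"
  then obtain p u v q where "is_walk G \<alpha>" "\<alpha> = p @ [u, v, u] @ q" "\<beta> = p @ [u] @ q"
    by blast
  then show "prunes_to G \<alpha> \<beta>"
    by (auto simp: prunes_to_def nth_append intro!: exI[of _ "length p"])
qed

lemma homotopic_rel_endpointsE:
  assumes "homotopic_rel_endpoints G \<alpha> \<beta>"
  obtains n m \<Lambda> where "is_walk G \<alpha>" "is_walk G \<beta>" "hd \<alpha> = hd \<beta>" "last \<alpha> = last \<beta>"
    "length \<alpha> = n + 1" "length \<beta> = n + 1"
    "graph_morphism (graph_prod (path_graph n) (looped_path_graph m)) G \<Lambda>"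
    "\<forall>i\<le>n. \<Lambda> (i, 0) = \<alpha> ! i" "\<forall>i\<le>n. \<Lambda> (i, m) = \<beta> ! i"
    "\<forall>j\<le>m. \<Lambda> (0, j) = hd \<alpha> \<and> \<Lambda> (n, j) = last \<alpha>"
  using assms unfolding homotopic_rel_endpoints_def walks_def by fastforce

lemma homotopic_rel_endpointsI:
  assumes "is_walk G \<alpha>" "is_walk G \<beta>" "hd \<alpha> = hd \<beta>" "last \<alpha> = last \<beta>"
    "length \<alpha> = n + 1" "length \<beta> = n + 1"
    "graph_morphism (graph_prod (path_graph n) (looped_path_graph m)) G \<Lambda>"
    "\<forall>i\<le>n. \<Lambda> (i, 0) = \<alpha> ! i" "\<forall>i\<le>n. \<Lambda> (i, m) = \<beta> ! i"
    "\<forall>j\<le>m. \<Lambda> (0, j) = hd \<alpha> \<and> \<Lambda> (n, j) = last \<alpha>"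
  shows "homotopic_rel_endpoints G \<alpha> \<beta>"
  unfolding homotopic_rel_endpoints_def
proof (intro exI conjI)
  show "\<alpha> \<in> walks G (hd \<alpha>) (last \<alpha>)" "\<beta> \<in> walks G (hd \<alpha>) (last \<alpha>)"
    using assms(1-4) by (simp_all add: walks_def)
qed (use assms in auto)

section \<open>The generating steps and the equivalence they generate\<close>

definition walk_step :: "'a graph \<Rightarrow> 'a list \<Rightarrow> 'a list \<Rightarrow> bool" where
  "walk_step G \<alpha> \<beta> \<longleftrightarrow> prunes_to G \<alpha> \<beta> \<or> homotopic_rel_endpoints G \<alpha> \<beta>"

lemma walk_equiv_eq: "walk_equiv G = equivclp (walk_step G)"
  by (simp add: walk_equiv_def walk_step_def[abs_def])

lemma walk_step_imp_walk_equiv: "walk_step G \<alpha> \<beta> \<Longrightarrow> walk_equiv G \<alpha> \<beta>"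
  by (simp add: walk_equiv_eq r_into_equivclp)

lemma walk_equiv_refl: "walk_equiv G \<alpha> \<alpha>"
  by (simp add: walk_equiv_eq equivclp_refl)

lemma walk_equiv_sym: "walk_equiv G \<alpha> \<beta> \<Longrightarrow> walk_equiv G \<beta> \<alpha>"
  by (simp add: walk_equiv_eq equivclp_sym)

lemma walk_equiv_trans: "walk_equiv G \<alpha> \<beta> \<Longrightarrow> walk_equiv G \<beta> \<gamma> \<Longrightarrow> walk_equiv G \<alpha> \<gamma>"
  unfolding walk_equiv_eq by (rule equivclp_trans)

text \<open>In a prune the surviving \<open>u\<close> inherits its left neighbour from the first
  copy and its right neighbour from the last copy, so the result is a walk. The ends survive even
  when \<open>p\<close> or \<open>q\<close> is empty, since \<open>u\<close> then is the end
  itself.\<close>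

lemma walk_step_endpoints:
  assumes "is_graph G" "walk_step G \<alpha> \<beta>"
  shows "is_walk G \<alpha> \<and> is_walk G \<beta> \<and> hd \<alpha> = hd \<beta> \<and> last \<alpha> = last \<beta>"
  using assms(2) unfolding walk_step_def
proof
  assume "prunes_to G \<alpha> \<beta>"
  then obtain p u v q where "is_walk G \<alpha>" "\<alpha> = p @ [u, v, u] @ q" "\<beta> = p @ [u] @ q"
    by (auto simp: prunes_to_iff)
  with assms(1) show ?thesis
    by (auto simp: is_walk_iff_successively successively_append_iff successively_Cons hd_append)
qed (auto elim: homotopic_rel_endpointsE)

text \<open>Induction along a chain of steps from \<alpha>. Walkhood and endpoints are part of the
  induction claim, so \<open>f\<close> has to respect only those steps whose endpoints are those of
  \<alpha>. The target graph may differ from \<open>G\<close>, which covers images under morphisms;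
  the identity as \<open>f\<close> yields invariance of endpoints.\<close>

lemma walk_equiv_lift:
  assumes "is_graph G" "walk_equiv G \<alpha> \<beta>" "is_walk G \<alpha>"
    and step: "\<And>\<gamma> \<delta>. \<lbrakk>walk_step G \<gamma> \<delta>; hd \<gamma> = hd \<alpha>; last \<gamma> = last \<alpha>\<rbrakk> \<Longrightarrow> walk_step H (f \<gamma>) (f \<delta>)"
  shows "is_walk G \<beta> \<and> hd \<beta> = hd \<alpha> \<and> last \<beta> = last \<alpha> \<and> walk_equiv H (f \<alpha>) (f \<beta>)"
  using assms(2) unfolding walk_equiv_eq[of G]
proof (induction rule: equivclp_induct)
  case base
  then show ?case by (simp add: assms(3) walk_equiv_refl)
next
  case (step \<gamma> \<delta>)
  then have *: "is_walk G \<delta> \<and> hd \<delta> = hd \<gamma> \<and> last \<delta> = last \<gamma>"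
    using walk_step_endpoints[OF assms(1)] by metis
  \<comment> \<open>The step may run in either direction. Since \<gamma> and \<delta> share
    endpoints, the assumption on \<open>f\<close> applies to both orientations, and symmetry settles
    the reversed one.\<close>
  from step.hyps(2) have "walk_equiv H (f \<gamma>) (f \<delta>)"
    using * step.IH assms(4) by (metis walk_step_imp_walk_equiv walk_equiv_sym)
  with * step.IH show ?case
    by (auto intro: walk_equiv_trans)
qed

lemma walk_equiv_endpoints:
  assumes "is_graph G" "walk_equiv G \<alpha> \<beta>" "is_walk G \<alpha>"
  shows "is_walk G \<beta> \<and> hd \<beta> = hd \<alpha> \<and> last \<beta> = last \<alpha>"
  using walk_equiv_lift[OF assms, of G "\<lambda>\<gamma>. \<gamma>"] by simp

text \<open>A prune keeps its shape with a longer prefix. A homotopy gains a column constant at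
  \<open>v\<close>: a product edge between this column and the next maps to the edge from
  \<open>v\<close> to \<open>hd \<alpha>\<close> or its reverse, whatever the two times are. The
  path graph has no loops, so no product edge lies inside the new column and \<open>v\<close> may be
  loopless.\<close>

lemma walk_step_Cons:
  assumes "is_graph G" "walk_step G \<alpha> \<beta>" "(v, hd \<alpha>) \<in> adj G"
  shows "walk_step G (v # \<alpha>) (v # \<beta>)"
proof -
  from walk_step_endpoints[OF assms(1,2)] assms(1,3)
  have walks: "is_walk G (v # \<alpha>)" "is_walk G (v # \<beta>)"
    by (metis is_walk_Cons is_walk_def)+
  from assms(2) show ?thesis
    unfolding walk_step_def
  proof
    assume "prunes_to G \<alpha> \<beta>"
    with walks have "prunes_to G (v # \<alpha>) (v # \<beta>)"
      unfolding prunes_to_iff by (metis append_Cons)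
    then show "prunes_to G (v # \<alpha>) (v # \<beta>) \<or> homotopic_rel_endpoints G (v # \<alpha>) (v # \<beta>)" ..
  next
    assume "homotopic_rel_endpoints G \<alpha> \<beta>"
    then obtain n m \<Lambda> where \<Lambda>: "hd \<alpha> = hd \<beta>" "last \<alpha> = last \<beta>"
      "length \<alpha> = n + 1" "length \<beta> = n + 1"
      "graph_morphism (graph_prod (path_graph n) (looped_path_graph m)) G \<Lambda>"
      "\<forall>i\<le>n. \<Lambda> (i, 0) = \<alpha> ! i" "\<forall>i\<le>n. \<Lambda> (i, m) = \<beta> ! i"
      "\<forall>j\<le>m. \<Lambda> (0, j) = hd \<alpha> \<and> \<Lambda> (n, j) = last \<alpha>"
      by (elim homotopic_rel_endpointsE) blast
    \<comment> \<open>Column 0 is the new one, and the old column \<open>k\<close> moves to position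
      \<open>k + 1\<close>.\<close>
    define \<Lambda>' where "\<Lambda>' = (\<lambda>(i, j). case i of 0 \<Rightarrow> v | Suc k \<Rightarrow> \<Lambda> (k, j))"
    have v: "v \<in> verts G" "(hd \<alpha>, v) \<in> adj G"
      using assms(1,3) by (auto simp: is_graph_def sym_def)
    have "graph_morphism (graph_prod (path_graph (n + 1)) (looped_path_graph m)) G \<Lambda>'"
      using \<Lambda>(5,8) v assms(3) unfolding \<Lambda>'_def
      by (auto simp: graph_morphism_def graph_prod_def path_graph_def looped_path_graph_def Pi_iff
          split: nat.split)
    then have "homotopic_rel_endpoints G (v # \<alpha>) (v # \<beta>)"
      by (rule homotopic_rel_endpointsI[rotated 6])
        (use walks \<Lambda> in \<open>auto simp: \<Lambda>'_def nth_Cons split: nat.split\<close>)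
    then show "prunes_to G (v # \<alpha>) (v # \<beta>) \<or> homotopic_rel_endpoints G (v # \<alpha>) (v # \<beta>)" ..
  qed
qed

lemma walk_step_snoc:
  assumes "is_graph G" "walk_step G \<alpha> \<beta>" "(last \<alpha>, v) \<in> adj G"
  shows "walk_step G (\<alpha> @ [v]) (\<beta> @ [v])"
proof -
  from walk_step_endpoints[OF assms(1,2)] assms(1,3)
  have walks: "is_walk G (\<alpha> @ [v])" "is_walk G (\<beta> @ [v])"
    by (metis is_walk_snoc is_walk_def)+
  from assms(2) show ?thesis
    unfolding walk_step_def
  proof
    assume "prunes_to G \<alpha> \<beta>"
    with walks have "prunes_to G (\<alpha> @ [v]) (\<beta> @ [v])"
      unfolding prunes_to_iff by (metis append_assoc)
    then show "prunes_to G (\<alpha> @ [v]) (\<beta> @ [v]) \<or> homotopic_rel_endpoints G (\<alpha> @ [v]) (\<beta> @ [v])" ..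
  next
    assume "homotopic_rel_endpoints G \<alpha> \<beta>"
    then obtain n m \<Lambda> where \<Lambda>: "hd \<alpha> = hd \<beta>" "last \<alpha> = last \<beta>"
      "length \<alpha> = n + 1" "length \<beta> = n + 1"
      "graph_morphism (graph_prod (path_graph n) (looped_path_graph m)) G \<Lambda>"
      "\<forall>i\<le>n. \<Lambda> (i, 0) = \<alpha> ! i" "\<forall>i\<le>n. \<Lambda> (i, m) = \<beta> ! i"
      "\<forall>j\<le>m. \<Lambda> (0, j) = hd \<alpha> \<and> \<Lambda> (n, j) = last \<alpha>"
      by (elim homotopic_rel_endpointsE) blast
    \<comment> \<open>The old columns keep their positions; \<open>else\<close> concerns the new
      last column \<open>n + 1\<close>, whose only neighbour is column \<open>n\<close>, constant at
      \<open>last \<alpha>\<close>.\<close>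
    define \<Lambda>' where "\<Lambda>' = (\<lambda>(i, j). if i \<le> n then \<Lambda> (i, j) else v)"
    have ne: "\<alpha> \<noteq> []" "\<beta> \<noteq> []"
      using \<Lambda>(3,4) by auto
    have v: "v \<in> verts G" "(v, last \<alpha>) \<in> adj G"
      using assms(1,3) by (auto simp: is_graph_def sym_def)
    have "graph_morphism (graph_prod (path_graph (n + 1)) (looped_path_graph m)) G \<Lambda>'"
      using \<Lambda>(5,8) v assms(3) unfolding \<Lambda>'_def
      by (auto simp: graph_morphism_def graph_prod_def path_graph_def looped_path_graph_def Pi_iff
          le_Suc_eq)
    then have "homotopic_rel_endpoints G (\<alpha> @ [v]) (\<beta> @ [v])"
      by (rule homotopic_rel_endpointsI[rotated 6])
        (use walks \<Lambda> ne in \<open>auto simp: \<Lambda>'_def nth_append le_Suc_eq\<close>)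
    then show "prunes_to G (\<alpha> @ [v]) (\<beta> @ [v]) \<or> homotopic_rel_endpoints G (\<alpha> @ [v]) (\<beta> @ [v])" ..
  qed
qed

text \<open>The pattern \<open>u v u\<close> is preserved by any function on entries, and a homotopy
  \<Lambda> is carried to the composite of \<phi> with \<Lambda>.\<close>

lemma walk_step_map:
  assumes "walk_step G \<alpha> \<beta>" "graph_morphism G H \<phi>"
  shows "walk_step H (map \<phi> \<alpha>) (map \<phi> \<beta>)"
  using assms(1) unfolding walk_step_def
proof
  assume "prunes_to G \<alpha> \<beta>"
  then have "prunes_to H (map \<phi> \<alpha>) (map \<phi> \<beta>)"
    using is_walk_map[OF _ assms(2)] unfolding prunes_to_iff by fastforce
  then show "prunes_to H (map \<phi> \<alpha>) (map \<phi> \<beta>) \<or> homotopic_rel_endpoints H (map \<phi> \<alpha>) (map \<phi> \<beta>)" ..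
next
  assume "homotopic_rel_endpoints G \<alpha> \<beta>"
  then obtain n m \<Lambda> where \<Lambda>: "is_walk G \<alpha>" "is_walk G \<beta>" "hd \<alpha> = hd \<beta>" "last \<alpha> = last \<beta>"
    "length \<alpha> = n + 1" "length \<beta> = n + 1"
    "graph_morphism (graph_prod (path_graph n) (looped_path_graph m)) G \<Lambda>"
    "\<forall>i\<le>n. \<Lambda> (i, 0) = \<alpha> ! i" "\<forall>i\<le>n. \<Lambda> (i, m) = \<beta> ! i"
    "\<forall>j\<le>m. \<Lambda> (0, j) = hd \<alpha> \<and> \<Lambda> (n, j) = last \<alpha>"
    by (elim homotopic_rel_endpointsE) blast
  have "\<alpha> \<noteq> []" "\<beta> \<noteq> []"
    using \<Lambda>(5,6) by auto
  with \<Lambda> have "homotopic_rel_endpoints H (map \<phi> \<alpha>) (map \<phi> \<beta>)"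
    by (intro homotopic_rel_endpointsI[OF _ _ _ _ _ _ graph_morphism_comp[OF \<Lambda>(7) assms(2)]])
      (simp_all add: is_walk_map[OF _ assms(2)] hd_map last_map)
  then show "prunes_to H (map \<phi> \<alpha>) (map \<phi> \<beta>) \<or> homotopic_rel_endpoints H (map \<phi> \<alpha>) (map \<phi> \<beta>)" ..
qed

section \<open>Compatibility of the equivalence with concatenation and morphisms\<close>

lemma walk_equiv_Cons:
  assumes "is_graph G" "walk_equiv G \<alpha> \<beta>" "is_walk G (v # \<alpha>)" "\<alpha> \<noteq> []"
  shows "walk_equiv G (v # \<alpha>) (v # \<beta>)"
proof -
  have walk: "is_walk G \<alpha>" and v: "(v, hd \<alpha>) \<in> adj G"
    using assms(3) is_walk_Cons[OF assms(1,4)] by simp_all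
  have "walk_step G (v # \<gamma>) (v # \<delta>)" if "walk_step G \<gamma> \<delta>" "hd \<gamma> = hd \<alpha>" for \<gamma> \<delta>
    using that v by (intro walk_step_Cons[OF assms(1)]) simp_all
  from walk_equiv_lift[where f = "(#) v", OF assms(1,2) walk this] show ?thesis by blast
qed

lemma walk_equiv_snoc:
  assumes "is_graph G" "walk_equiv G \<alpha> \<beta>" "is_walk G (\<alpha> @ [v])" "\<alpha> \<noteq> []"
  shows "walk_equiv G (\<alpha> @ [v]) (\<beta> @ [v])"
proof -
  have walk: "is_walk G \<alpha>" and v: "(last \<alpha>, v) \<in> adj G"
    using assms(3) is_walk_snoc[OF assms(1,4)] by simp_all
  have "walk_step G (\<gamma> @ [v]) (\<delta> @ [v])" if "walk_step G \<gamma> \<delta>" "last \<gamma> = last \<alpha>" for \<gamma> \<delta>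
    using that v by (intro walk_step_snoc[OF assms(1)]) simp_all
  from walk_equiv_lift[where f = "\<lambda>\<gamma>. \<gamma> @ [v]", OF assms(1,2) walk this] show ?thesis by blast
qed

lemma walk_equiv_append_left:
  assumes "is_graph G" "walk_equiv G \<alpha> \<beta>" "is_walk G (\<gamma> @ \<alpha>)" "\<alpha> \<noteq> []"
  shows "walk_equiv G (\<gamma> @ \<alpha>) (\<gamma> @ \<beta>)"
  using assms(3)
proof (induction \<gamma>)
  case (Cons v \<gamma>)
  then have "is_walk G (\<gamma> @ \<alpha>)"
    using assms(1,4) is_walk_Cons[of G "\<gamma> @ \<alpha>" v] by simp
  with Cons show ?case
    using walk_equiv_Cons[of G "\<gamma> @ \<alpha>" "\<gamma> @ \<beta>" v] assms(1,4) by simp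
qed (simp add: assms(2))

lemma walk_equiv_append_right:
  assumes "is_graph G" "walk_equiv G \<alpha> \<beta>" "is_walk G (\<alpha> @ \<delta>)" "\<alpha> \<noteq> []"
  shows "walk_equiv G (\<alpha> @ \<delta>) (\<beta> @ \<delta>)"
  using assms(3)
proof (induction \<delta> rule: rev_induct)
  case (snoc v \<delta>)
  then have "is_walk G (\<alpha> @ \<delta>)"
    using assms(1,4) is_walk_snoc[of G "\<alpha> @ \<delta>" v] by simp
  with snoc show ?case
    using walk_equiv_snoc[of G "\<alpha> @ \<delta>" "\<beta> @ \<delta>" v] assms(1,4) by simp
qed (simp add: assms(2))

lemma walk_equiv_in_walks:
  "\<lbrakk>is_graph G; \<alpha> \<in> walks G x y; walk_equiv G \<alpha> \<beta>\<rbrakk> \<Longrightarrow> \<beta> \<in> walks G x y"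
  using walk_equiv_endpoints[of G \<alpha> \<beta>] by (simp add: walks_def)

lemma walk_equiv_walk_concat:
  assumes G: "is_graph G" and "\<alpha> \<in> walks G x y" "\<beta> \<in> walks G y z"
    and "walk_equiv G \<alpha> \<alpha>'" "walk_equiv G \<beta> \<beta>'"
  shows "walk_equiv G (walk_concat \<alpha> \<beta>) (walk_concat \<alpha>' \<beta>')"
proof -
  have \<alpha>': "\<alpha>' \<in> walks G x y" and \<beta>': "\<beta>' \<in> walks G y z"
    using walk_equiv_in_walks[OF G] assms(2-5) by simp_all
  have "is_walk G (\<alpha> @ tl \<beta>)" "\<alpha> \<noteq> []"
    using walk_concat_walks[OF assms(1-3)] assms(2)
    by (auto simp: walks_def walk_concat_def is_walk_def)
  then have 1: "walk_equiv G (walk_concat \<alpha> \<beta>) (walk_concat \<alpha>' \<beta>)"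
    unfolding walk_concat_def using G assms(4) by (intro walk_equiv_append_right)
  \<comment> \<open>Concatenation by definition drops the shared vertex \<open>y\<close> from the
    second walk, but replacing \<beta> by \<beta>' needs the second walk intact. Dropping
    \<open>y\<close> from the first walk instead gives the same list.\<close>
  have shift: "walk_concat \<alpha>' \<gamma> = butlast \<alpha>' @ \<gamma>" if \<gamma>: "\<gamma> \<in> walks G y z" for \<gamma>
  proof -
    obtain p where "\<alpha>' = p @ [y]"
      using \<alpha>' by (cases \<alpha>' rule: rev_cases) (auto simp: walks_def is_walk_def)
    moreover obtain q where "\<gamma> = y # q"
      using \<gamma> by (cases \<gamma>) (auto simp: walks_def is_walk_def)
    ultimately show ?thesis by (simp add: walk_concat_def)
  qed
  have "is_walk G (butlast \<alpha>' @ \<beta>)" "\<beta> \<noteq> []"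
    using walk_concat_walks[OF G \<alpha>' assms(3)] assms(3)
    by (auto simp: shift walks_def is_walk_def)
  then have "walk_equiv G (walk_concat \<alpha>' \<beta>) (walk_concat \<alpha>' \<beta>')"
    unfolding shift[OF assms(3)] shift[OF \<beta>'] using G assms(5) by (intro walk_equiv_append_left)
  with 1 show ?thesis by (rule walk_equiv_trans)
qed

lemma walk_equiv_map:
  assumes "is_graph G" "graph_morphism G H \<phi>" "is_walk G \<alpha>" "walk_equiv G \<alpha> \<beta>"
  shows "walk_equiv H (map \<phi> \<alpha>) (map \<phi> \<beta>)"
  using walk_equiv_lift[where f = "map \<phi>", OF assms(1,4,3) walk_step_map[OF _ assms(2)]] by blast

section \<open>Reversal as inverse up to equivalence\<close>

lemma walk_equiv_concat_rev:
  assumes "is_graph G" "is_walk G \<alpha>"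
  shows "walk_equiv G (walk_concat \<alpha> (rev \<alpha>)) [hd \<alpha>]"
  using assms(2)
proof (induction \<alpha>)
  case (Cons x \<beta>)
  show ?case
  proof (cases "\<beta> = []")
    case True
    then show ?thesis by (simp add: walk_concat_def walk_equiv_refl)
  next
    case False
    then have \<beta>: "is_walk G \<beta>"
      using Cons.prems assms(1) by (simp add: is_walk_Cons)
    have eq: "walk_concat (x # \<beta>) (rev (x # \<beta>)) = x # walk_concat \<beta> (rev \<beta>) @ [x]"
      using False by (simp add: walk_concat_def)
    have x\<beta>: "x # \<beta> \<in> walks G x (last \<beta>)"
      using Cons.prems False by (simp add: walks_def)
    then have "walk_concat (x # \<beta>) (rev (x # \<beta>)) \<in> walks G x x"
      using assms(1) by (intro walk_concat_walks walks_rev)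
    then have w: "is_walk G ([x] @ (walk_concat \<beta> (rev \<beta>) @ [x]))"
      unfolding eq by (simp add: walks_def)
    have ne: "walk_concat \<beta> (rev \<beta>) \<noteq> []"
      using False by (simp add: walk_concat_def)
    have "is_walk G (walk_concat \<beta> (rev \<beta>) @ [x])"
      using w assms(1) ne is_walk_Cons[of G "walk_concat \<beta> (rev \<beta>) @ [x]" x] by simp
    with Cons.IH[OF \<beta>] have "walk_equiv G (walk_concat \<beta> (rev \<beta>) @ [x]) ([hd \<beta>] @ [x])"
      using assms(1) ne by (intro walk_equiv_append_right)
    then have 1: "walk_equiv G ([x] @ (walk_concat \<beta> (rev \<beta>) @ [x])) ([x] @ ([hd \<beta>] @ [x]))"
      using assms(1) w by (intro walk_equiv_append_left) auto
    \<comment> \<open>Being a walk is inherited along the equivalence; the prune requires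
      it.\<close>
    then have "is_walk G [x, hd \<beta>, x]"
      using walk_equiv_endpoints[OF assms(1) 1 w] by simp
    then have "prunes_to G [x, hd \<beta>, x] [x]"
      by (auto simp: prunes_to_def intro!: exI[of _ 0])
    then have "walk_equiv G [x, hd \<beta>, x] [x]"
      by (simp add: walk_step_imp_walk_equiv walk_step_def)
    with 1 show ?thesis
      unfolding eq by (auto intro: walk_equiv_trans)
  qed
qed (simp add: is_walk_def)


section \<open>The fundamental groupoid\<close>

lemma mem_walk_class: "\<beta> \<in> walk_class G \<alpha> \<longleftrightarrow> is_walk G \<beta> \<and> walk_equiv G \<alpha> \<beta>"
  by (simp add: walk_class_def)

lemma walk_class_eqI: "walk_equiv G \<alpha> \<beta> \<Longrightarrow> walk_class G \<alpha> = walk_class G \<beta>"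
  unfolding walk_class_def by (blast intro: walk_equiv_sym walk_equiv_trans)

text \<open>A constant family over a nonempty index set has its common value as union; the first
  premise provides nonemptiness. This turns the operations defined by unions into formulas on one
  representative.\<close>

lemma Union_walk_class:
  assumes "\<alpha> \<in> walk_class G \<alpha>" "\<And>\<beta>. \<beta> \<in> walk_class G \<alpha> \<Longrightarrow> f \<beta> = f \<alpha>"
  shows "(\<Union>\<beta>\<in>walk_class G \<alpha>. f \<beta>) = f \<alpha>"
proof -
  have "(\<Union>\<beta>\<in>walk_class G \<alpha>. f \<beta>) = (\<Union>\<beta>\<in>walk_class G \<alpha>. f \<alpha>)"
    by (intro SUP_cong refl assms(2))
  also have "\<dots> = f \<alpha>"
    using assms(1) by auto
  finally show ?thesis .
qed

lemma Comp_walk_class: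
  assumes G: "is_graph G" and \<alpha>: "\<alpha> \<in> walks G x y" and \<beta>: "\<beta> \<in> walks G y z"
  shows "Comp (fundamental_groupoid G) x' y' z' (walk_class G \<beta>) (walk_class G \<alpha>)
    = walk_class G (walk_concat \<alpha> \<beta>)"
proof -
  have mem: "\<alpha> \<in> walk_class G \<alpha>" "\<beta> \<in> walk_class G \<beta>"
    using \<alpha> \<beta> by (simp_all add: mem_walk_class walks_def walk_equiv_refl)
  have eq: "walk_class G (walk_concat \<alpha>' \<beta>') = walk_class G (walk_concat \<alpha> \<beta>)"
    if "\<alpha>' \<in> walk_class G \<alpha>" "\<beta>' \<in> walk_class G \<beta>" for \<alpha>' \<beta>'
    using walk_equiv_walk_concat[OF G \<alpha> \<beta>] that
    by (intro walk_class_eqI[symmetric]) (simp add: mem_walk_class)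
  have "(\<Union>\<beta>'\<in>walk_class G \<beta>. walk_class G (walk_concat \<alpha>' \<beta>')) = walk_class G (walk_concat \<alpha> \<beta>)"
    if "\<alpha>' \<in> walk_class G \<alpha>" for \<alpha>'
    using Union_walk_class[OF mem(2), of "\<lambda>\<beta>'. walk_class G (walk_concat \<alpha>' \<beta>')"]
      eq[OF that] mem(2) by simp
  then have "(\<Union>\<alpha>'\<in>walk_class G \<alpha>. \<Union>\<beta>'\<in>walk_class G \<beta>. walk_class G (walk_concat \<alpha>' \<beta>'))
      = walk_class G (walk_concat \<alpha> \<beta>)"
    using Union_walk_class[OF mem(1), of "\<lambda>\<alpha>'. \<Union>\<beta>'\<in>walk_class G \<beta>. walk_class G (walk_concat \<alpha>' \<beta>')"]
      mem(1) by simp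
  then show ?thesis
    by (simp add: fundamental_groupoid_def)
qed

lemma fundamental_groupoid_simps:
  "Obj (fundamental_groupoid G) = verts G"
  "Hom (fundamental_groupoid G) x y = walk_class G ` walks G x y"
  "Ident (fundamental_groupoid G) x = walk_class G [x]"
  by (simp_all add: fundamental_groupoid_def)

lemma singleton_walks: "is_graph G \<Longrightarrow> x \<in> verts G \<Longrightarrow> [x] \<in> walks G x x"
  by (simp add: walks_def is_walk_singleton)

text \<open>Once composition is computed on representatives, the unit and associativity laws are the
  strict ones for lists. Inverses alone hold only up to equivalence.\<close>

lemma groupoid_fundamental_groupoid:
  assumes G: "is_graph G"
  shows "groupoid (fundamental_groupoid G)"
proof (unfold_locales, unfold fundamental_groupoid_simps)
  fix x assume "x \<in> verts G"
  then show "walk_class G [x] \<in> walk_class G ` walks G x x"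
    by (intro imageI singleton_walks[OF G])
next
  fix x y z f g
  assume "f \<in> walk_class G ` walks G x y" "g \<in> walk_class G ` walks G y z"
  then obtain \<alpha> \<beta> where *: "\<alpha> \<in> walks G x y" "f = walk_class G \<alpha>"
      "\<beta> \<in> walks G y z" "g = walk_class G \<beta>"
    by blast
  show "Comp (fundamental_groupoid G) x y z g f \<in> walk_class G ` walks G x z"
    unfolding *(2,4) Comp_walk_class[OF G *(1,3)] using walk_concat_walks[OF G *(1,3)] by (rule imageI)
next
  fix x y f
  assume x: "x \<in> verts G" and y: "y \<in> verts G" and "f \<in> walk_class G ` walks G x y"
  then obtain \<alpha> where \<alpha>: "\<alpha> \<in> walks G x y" "f = walk_class G \<alpha>" by blast
  then have ends: "\<alpha> \<noteq> []" "hd \<alpha> = x" "last \<alpha> = y" "is_walk G \<alpha>"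
    by (auto simp: walks_def is_walk_def)
  show "Comp (fundamental_groupoid G) x x y f (walk_class G [x]) = f"
    using Comp_walk_class[OF G singleton_walks[OF G x] \<alpha>(1)] ends
      walk_concat_singleton_left[of \<alpha>] by (simp add: \<alpha>(2))
  show "Comp (fundamental_groupoid G) x y y (walk_class G [y]) f = f"
    using Comp_walk_class[OF G \<alpha>(1) singleton_walks[OF G y]]
    by (simp add: \<alpha>(2) walk_concat_singleton_right)
  have rev: "rev \<alpha> \<in> walks G y x"
    using walks_rev[OF G \<alpha>(1)] .
  \<comment> \<open>The second relation is the first one for \<open>rev \<alpha>\<close>, whose
    reversal is \<alpha> and whose first entry is \<open>y\<close>.\<close>
  have "walk_equiv G (walk_concat \<alpha> (rev \<alpha>)) [x]" "walk_equiv G (walk_concat (rev \<alpha>) \<alpha>) [y]"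
    using walk_equiv_concat_rev[OF G, of \<alpha>] walk_equiv_concat_rev[OF G, of "rev \<alpha>"] ends
    by (simp_all add: is_walk_rev[OF G] hd_rev)
  note this[THEN walk_class_eqI]
  then have "Comp (fundamental_groupoid G) x y x (walk_class G (rev \<alpha>)) f = walk_class G [x]"
    "Comp (fundamental_groupoid G) y x y f (walk_class G (rev \<alpha>)) = walk_class G [y]"
    unfolding \<alpha>(2) Comp_walk_class[OF G \<alpha>(1) rev] Comp_walk_class[OF G rev \<alpha>(1)]
    by simp_all
  with rev show "\<exists>g\<in>walk_class G ` walks G y x.
      Comp (fundamental_groupoid G) x y x g f = walk_class G [x] \<and>
      Comp (fundamental_groupoid G) y x y f g = walk_class G [y]"
    by (intro bexI[of _ "walk_class G (rev \<alpha>)"] conjI imageI)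
next
  fix w x y z f g h
  assume "f \<in> walk_class G ` walks G w x" "g \<in> walk_class G ` walks G x y"
    "h \<in> walk_class G ` walks G y z"
  then obtain \<alpha> \<beta> \<gamma> where *: "\<alpha> \<in> walks G w x" "f = walk_class G \<alpha>"
      "\<beta> \<in> walks G x y" "g = walk_class G \<beta>" "\<gamma> \<in> walks G y z" "h = walk_class G \<gamma>"
    by blast
  then have "\<beta> \<noteq> []" by (auto simp: walks_def is_walk_def)
  then show "Comp (fundamental_groupoid G) w y z h (Comp (fundamental_groupoid G) w x y g f) =
      Comp (fundamental_groupoid G) w x z (Comp (fundamental_groupoid G) x y z h g) f"
    unfolding *(2,4,6) Comp_walk_class[OF G *(1,3)] Comp_walk_class[OF G *(3,5)]
      Comp_walk_class[OF G walk_concat_walks[OF G *(1,3)] *(5)]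
      Comp_walk_class[OF G *(1) walk_concat_walks[OF G *(3,5)]]
    by (simp add: walk_concat_assoc)
qed


section \<open>Functoriality\<close>

lemma omap_induced_functor: "v \<in> verts G \<Longrightarrow> omap (induced_functor G H \<phi>) v = \<phi> v"
  by (simp add: induced_functor_def fundamental_groupoid_simps)

lemma amap_induced_functor:
  assumes G: "is_graph G" and \<phi>: "graph_morphism G H \<phi>"
    and "x \<in> verts G" "y \<in> verts G" and \<alpha>: "\<alpha> \<in> walks G x y"
  shows "amap (induced_functor G H \<phi>) x y (walk_class G \<alpha>) = walk_class H (map \<phi> \<alpha>)"
proof -
  have walk: "is_walk G \<alpha>" using \<alpha> by (simp add: walks_def)
  have "(\<Union>\<beta>\<in>walk_class G \<alpha>. walk_class H (map \<phi> \<beta>)) = walk_class H (map \<phi> \<alpha>)"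
    using walk walk_equiv_map[OF G \<phi> walk]
    by (intro Union_walk_class walk_class_eqI[symmetric]) (simp_all add: mem_walk_class walk_equiv_refl)
  with assms show ?thesis
    by (simp add: induced_functor_def fundamental_groupoid_simps)
qed

lemma is_functor_induced_functor:
  assumes G: "is_graph G" and H: "is_graph H" and \<phi>: "graph_morphism G H \<phi>"
  shows "is_functor (fundamental_groupoid G) (fundamental_groupoid H) (induced_functor G H \<phi>)"
proof -
  note amap = amap_induced_functor[OF G \<phi>]
  interpret \<Pi>G: groupoid "fundamental_groupoid G" by (rule groupoid_fundamental_groupoid[OF G])
  interpret \<Pi>H: groupoid "fundamental_groupoid H" by (rule groupoid_fundamental_groupoid[OF H])
  show ?thesis
  proof (unfold_locales, unfold fundamental_groupoid_simps)
    fix x assume x: "x \<in> verts G"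
    then show "omap (induced_functor G H \<phi>) x \<in> verts H"
      using \<phi> by (simp add: omap_induced_functor graph_morphism_in_verts)
    show "amap (induced_functor G H \<phi>) x x (walk_class G [x]) =
        walk_class H [omap (induced_functor G H \<phi>) x]"
      using amap[OF x x singleton_walks[OF G x]] x by (simp add: omap_induced_functor)
  next
    fix x y f assume "x \<in> verts G" "y \<in> verts G" "f \<in> walk_class G ` walks G x y"
    then show "amap (induced_functor G H \<phi>) x y f \<in>
        walk_class H ` walks H (omap (induced_functor G H \<phi>) x) (omap (induced_functor G H \<phi>) y)"
      using walks_map[OF _ \<phi>] by (auto simp: omap_induced_functor amap)
  next
    fix x y z f g
    assume *: "x \<in> verts G" "y \<in> verts G" "z \<in> verts G"
      "f \<in> walk_class G ` walks G x y" "g \<in> walk_class G ` walks G y z"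
    then obtain \<alpha> \<beta> where **: "\<alpha> \<in> walks G x y" "f = walk_class G \<alpha>"
        "\<beta> \<in> walks G y z" "g = walk_class G \<beta>"
      by blast
    show "amap (induced_functor G H \<phi>) x z (Comp (fundamental_groupoid G) x y z g f) =
      Comp (fundamental_groupoid H) (omap (induced_functor G H \<phi>) x) (omap (induced_functor G H \<phi>) y)
        (omap (induced_functor G H \<phi>) z)
        (amap (induced_functor G H \<phi>) y z g) (amap (induced_functor G H \<phi>) x y f)"
      using * ** walk_concat_walks[OF G **(1,3)]
      by (simp add: Comp_walk_class[OF G **(1,3)] amap map_walk_concat
          Comp_walk_class[OF H walks_map[OF **(1) \<phi>] walks_map[OF **(3) \<phi>]])
  qed
qed

text \<open>Entries of a walk are vertices. Thus \<open>Ident Gph G\<close> and composites in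
  \<open>Gph\<close>, which agree with the plain identity and composition only on vertices, act on
  walks as these do.\<close>

lemma map_cong_walk:
  assumes "is_graph G" "\<alpha> \<in> walks G x y" "\<And>v. v \<in> verts G \<Longrightarrow> f v = g v"
  shows "map f \<alpha> = map g \<alpha>"
  using assms by (auto simp: walks_def is_walk_iff_successively)

theorem theorem4p6:
  shows "is_functor (Gph :: ('a graph, 'a \<Rightarrow> 'a) cat) Grpd
           \<lparr>omap = fundamental_groupoid, amap = induced_functor\<rparr>
       \<and> (\<forall>(G :: 'a graph) (H :: 'a graph) \<phi>.
            G \<in> Obj Gph \<and> H \<in> Obj Gph \<and> \<phi> \<in> Hom Gph G H \<longrightarrow>
              (\<forall>v\<in>verts G. omap (induced_functor G H \<phi>) v = \<phi> v) \<and>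
              (\<forall>x\<in>verts G. \<forall>y\<in>verts G. \<forall>\<alpha>\<in>walks G x y.
                 amap (induced_functor G H \<phi>) x y (walk_class G \<alpha>) = walk_class H (map \<phi> \<alpha>)))"
proof (intro conjI allI impI ballI)
  interpret Gph: category "Gph :: ('a graph, 'a \<Rightarrow> 'a) cat" by (rule category_Gph)
  interpret Grpd: category "Grpd :: (('a, 'a list set) cat, ('a, 'a list set, 'a, 'a list set) cat_functor) cat"
    by (rule category_Grpd)
  have Obj: "G \<in> Obj Gph \<longleftrightarrow> is_graph G" for G :: "'a graph"
    by (simp add: Gph_def)
  have Hom: "\<phi> \<in> Hom Gph G H \<Longrightarrow> graph_morphism G H \<phi>" for G H :: "'a graph" and \<phi>
    by (simp add: Gph_def)
  have restrict: "restrict_functor (fundamental_groupoid G) (induced_functor G H \<phi>)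
      = induced_functor G H \<phi>" for G H :: "'a graph" and \<phi>
    by (simp add: induced_functor_def)
  show "is_functor (Gph :: ('a graph, 'a \<Rightarrow> 'a) cat) Grpd
      \<lparr>omap = fundamental_groupoid, amap = induced_functor\<rparr>"
  proof (unfold_locales, unfold cat_functor.simps)
    fix G :: "'a graph"
    assume G: "G \<in> Obj Gph"
    then show "fundamental_groupoid G \<in> Obj Grpd"
      by (simp add: Grpd_def groupoid_fundamental_groupoid Obj)
    note id = Hom[OF Gph.ident_hom[OF G]]
    show "induced_functor G G (Ident Gph G) = Ident Grpd (fundamental_groupoid G)"
    proof (rule normalised_functor_eqI[OF restrict])
      fix x y f
      assume x: "x \<in> Obj (fundamental_groupoid G)" and y: "y \<in> Obj (fundamental_groupoid G)"
        and f: "f \<in> Hom (fundamental_groupoid G) x y"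
      from f obtain \<alpha> where \<alpha>: "\<alpha> \<in> walks G x y" "f = walk_class G \<alpha>"
        by (auto simp: fundamental_groupoid_simps)
      have map_eq: "map (Ident Gph G) \<alpha> = map (\<lambda>v. v) \<alpha>"
        using G \<alpha>(1) by (intro map_cong_walk[of G]) (simp_all add: Obj, simp add: Gph_def)
      show "amap (induced_functor G G (Ident Gph G)) x y f
          = amap (Ident Grpd (fundamental_groupoid G)) x y f"
        using amap_induced_functor[OF _ id] G x y f \<alpha>
        by (simp add: Grpd_def Obj fundamental_groupoid_simps map_eq)
    qed (simp_all add: Grpd_def fundamental_groupoid_simps omap_induced_functor Gph_def)
  next
    fix G H :: "'a graph" and \<phi>
    assume "G \<in> Obj Gph" "H \<in> Obj Gph" "\<phi> \<in> Hom Gph G H"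
    then show "induced_functor G H \<phi> \<in> Hom Grpd (fundamental_groupoid G) (fundamental_groupoid H)"
      by (simp add: Grpd_def is_functor_induced_functor Obj Hom restrict)
  next
    fix G H K :: "'a graph" and \<phi> \<psi>
    assume *: "G \<in> Obj Gph" "H \<in> Obj Gph" "K \<in> Obj Gph" "\<phi> \<in> Hom Gph G H" "\<psi> \<in> Hom Gph H K"
    note \<phi> = Hom[OF *(4)] and \<psi> = Hom[OF *(5)] and comp = Hom[OF Gph.comp_hom[OF *]]
    have eq: "Comp Gph G H K \<psi> \<phi> v = \<psi> (\<phi> v)" if "v \<in> verts G" for v
      using that by (simp add: Gph_def compose_def)
    show "induced_functor G K (Comp Gph G H K \<psi> \<phi>) = Comp Grpd (fundamental_groupoid G)
        (fundamental_groupoid H) (fundamental_groupoid K)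
        (induced_functor H K \<psi>) (induced_functor G H \<phi>)"
    proof (rule normalised_functor_eqI[OF restrict])
      fix x y f
      assume x: "x \<in> Obj (fundamental_groupoid G)" and y: "y \<in> Obj (fundamental_groupoid G)"
        and f: "f \<in> Hom (fundamental_groupoid G) x y"
      from f obtain \<alpha> where \<alpha>: "\<alpha> \<in> walks G x y" "f = walk_class G \<alpha>"
        by (auto simp: fundamental_groupoid_simps)
      have map_eq: "map (Comp Gph G H K \<psi> \<phi>) \<alpha> = map (\<psi> \<circ> \<phi>) \<alpha>"
        using *(1) \<alpha>(1) by (intro map_cong_walk[of G]) (simp_all add: Obj eq)
      show "amap (induced_functor G K (Comp Gph G H K \<psi> \<phi>)) x y f
          = amap (Comp Grpd (fundamental_groupoid G) (fundamental_groupoid H)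
              (fundamental_groupoid K) (induced_functor H K \<psi>) (induced_functor G H \<phi>)) x y f"
        \<comment> \<open>The outer functor is evaluated at the class of
          \<open>map \<phi> \<alpha>\<close>, so this list must be known to be a walk in
          \<open>H\<close> between the images of \<open>x\<close> and \<open>y\<close>.\<close>
        using x y f \<alpha> * walks_map[OF \<alpha>(1) \<phi>]
          graph_morphism_in_verts[OF \<phi>]
        by (simp add: Grpd_def Obj fundamental_groupoid_simps omap_induced_functor
            amap_induced_functor \<phi> \<psi> comp map_eq)
    qed (use graph_morphism_in_verts[OF \<phi>] in
      \<open>simp_all add: Grpd_def fundamental_groupoid_simps omap_induced_functor eq\<close>)
  qed
next
  fix G H :: "'a graph" and \<phi> v
  assume "v \<in> verts G"
  then show "omap (induced_functor G H \<phi>) v = \<phi> v"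
    by (rule omap_induced_functor)
next
  fix G H :: "'a graph" and \<phi> x y \<alpha>
  assume "G \<in> Obj Gph \<and> H \<in> Obj Gph \<and> \<phi> \<in> Hom Gph G H"
    and "x \<in> verts G" "y \<in> verts G" "\<alpha> \<in> walks G x y"
  then show "amap (induced_functor G H \<phi>) x y (walk_class G \<alpha>) = walk_class H (map \<phi> \<alpha>)"
    by (intro amap_induced_functor) (simp_all add: Gph_def)
qed

end
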